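(* For every finite simple undirected graph $G$, $\operatorname{lbw}(G) \leq \operatorname{pw}(G) + 1$, where $\operatorname{lbw}(G)$ is the linear boolean-width of $G$ and $\operatorname{pw}(G)$ is the pathwidth of $G$.
   Context: Let $G=(V,E)$ be a finite simple undirected graph. For $A\subseteq V$ write $\overline{A}=V\setminus A$ and $N(X)=\bigcup_{x\in X}N(x)$. The set of unions of neighborhoods across the cut $(A,\overline{A})$ is $\mathcal{UN}(A)=\{N(X)\cap\overline{A} : X\subseteq A\}$, and the boolean dimension is $\operatorname{booldim}(A)=\log_2|\mathcal{UN}(A)|$. A decomposition tree of $G$ is a pair $(T,\delta)$ where $T$ is a full binary tree and $\delta$ is a bijection between the leaves of $T$ and $V$; for a node $w$ of $T$, $\delta(w)$ denotes the set of vertices mapped to the leaves of the subtree rooted at $w$. The boolean-width of $(T,\delta)$ is $\max_{w\in T}\operatorname{booldim}(\delta(w))$. A linear decomposition is a decomposition tree in which every internal node of $T$ has at least one leaf as a child. The linear boolean-width $\operatorname{lbw}(G)$ is the minimum boolean-width over all linear decompositions of $G$. Pathwidth is the standard graph parameter (minimum over path decompositions of the maximum bag size minus one). *)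

theory Defs
  imports Complex_Main "Graph_Theory.Pair_Digraph"
begin

text \<open>
  Finite simple undirected graphs are the values satisfying \<^const>\<open>pair_graph\<close>:
  a finite vertex set \<open>pverts G\<close> with a symmetric, irreflexive set of ordered pairs
  \<open>parcs G\<close>, an edge being represented by both of its orientations.
\<close>

subsection \<open>Boolean dimension\<close>

definition neighbors :: "'a pair_pre_digraph \<Rightarrow> 'a \<Rightarrow> 'a set" where
  "neighbors G v = {u \<in> pverts G. (v, u) \<in> parcs G}"

definition neighborhood :: "'a pair_pre_digraph \<Rightarrow> 'a set \<Rightarrow> 'a set" where
  "neighborhood G X = (\<Union>x\<in>X. neighbors G x)"

definition cut_unions :: "'a pair_pre_digraph \<Rightarrow> 'a set \<Rightarrow> 'a set set" where
  "cut_unions G A = {neighborhood G X \<inter> (pverts G - A) | X. X \<subseteq> A}"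

definition booldim :: "'a pair_pre_digraph \<Rightarrow> 'a set \<Rightarrow> real" where
  "booldim G A = log 2 (real (card (cut_unions G A)))"

subsection \<open>Decomposition trees\<close>

text \<open>
  A pair \<open>(T, \<delta>)\<close> is represented by a full binary tree whose leaves carry their
  image under \<open>\<delta>\<close>. A node is identified with the subtree rooted at it, so that
  \<open>\<delta>(w)\<close> is \<open>set (leaves w)\<close>.
\<close>

datatype 'a dtree = is_Leaf: Leaf 'a | Node "'a dtree" "'a dtree"

fun leaves :: "'a dtree \<Rightarrow> 'a list" where
  "leaves (Leaf v) = [v]"
| "leaves (Node l r) = leaves l @ leaves r"

fun nodes :: "'a dtree \<Rightarrow> 'a dtree set" where
  "nodes (Leaf v) = {Leaf v}"
| "nodes (Node l r) = insert (Node l r) (nodes l \<union> nodes r)"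

definition decomposition_tree :: "'a pair_pre_digraph \<Rightarrow> 'a dtree \<Rightarrow> bool" where
  "decomposition_tree G T \<longleftrightarrow> distinct (leaves T) \<and> set (leaves T) = pverts G"

definition booleanwidth_of :: "'a pair_pre_digraph \<Rightarrow> 'a dtree \<Rightarrow> real" where
  "booleanwidth_of G T = Max ((\<lambda>w. booldim G (set (leaves w))) ` nodes T)"

definition linear_decomposition :: "'a pair_pre_digraph \<Rightarrow> 'a dtree \<Rightarrow> bool" where
  "linear_decomposition G T \<longleftrightarrow>
     decomposition_tree G T \<and> (\<forall>l r. Node l r \<in> nodes T \<longrightarrow> is_Leaf l \<or> is_Leaf r)"

text \<open>
  The graph without vertices has no decomposition tree; its linear boolean-width is
  set to 0. For all other graphs the minimum ranges over a finite nonempty set, see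
  \<open>finite_linear_widths\<close> and \<open>linear_decomposition_exists\<close> below.
\<close>

definition lbw :: "'a pair_pre_digraph \<Rightarrow> real" where
  "lbw G = (if pverts G = {} then 0
            else Min {booleanwidth_of G T | T. linear_decomposition G T})"

subsection \<open>Pathwidth\<close>

definition path_decomposition :: "'a pair_pre_digraph \<Rightarrow> 'a set list \<Rightarrow> bool" where
  "path_decomposition G Bs \<longleftrightarrow>
     Bs \<noteq> [] \<and>
     \<Union> (set Bs) = pverts G \<and>
     (\<forall>(u, v) \<in> parcs G. \<exists>B \<in> set Bs. u \<in> B \<and> v \<in> B) \<and>
     (\<forall>i j k. i \<le> j \<and> j \<le> k \<and> k < length Bs \<longrightarrow> Bs ! i \<inter> Bs ! k \<subseteq> Bs ! j)"

definition max_bag_size :: "'a set list \<Rightarrow> nat" where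
  "max_bag_size Bs = Max (card ` set Bs)"

text \<open>Integer-valued, since the graph without vertices has pathwidth \<open>-1\<close>.\<close>

definition pathwidth :: "'a pair_pre_digraph \<Rightarrow> int" where
  "pathwidth G = int (LEAST s. \<exists>Bs. path_decomposition G Bs \<and> max_bag_size Bs = s) - 1"

subsection \<open>The minima are attained\<close>

lemma finite_nodes: "finite (nodes T)"
  by (induction T) auto

lemma nodes_self: "T \<in> nodes T"
  by (cases T) auto

lemma leaves_nodes_subset: "w \<in> nodes T \<Longrightarrow> set (leaves w) \<subseteq> set (leaves T)"
  by (induction T) auto

lemma finite_linear_widths:
  assumes "pair_graph G"
  shows "finite {booleanwidth_of G T | T. linear_decomposition G T}"
proof (rule finite_subset)
  have "finite (pverts G)"
    using assms by (simp add: pair_fin_digraph.pair_finite_verts pair_graph_def pair_digraph_def)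
  then show "finite (booldim G ` Pow (pverts G))" by simp
  show "{booleanwidth_of G T | T. linear_decomposition G T} \<subseteq> booldim G ` Pow (pverts G)"
  proof clarify
    fix T assume T: "linear_decomposition G T"
    have "booleanwidth_of G T \<in> (\<lambda>w. booldim G (set (leaves w))) ` nodes T"
      unfolding booleanwidth_of_def using finite_nodes[of T] nodes_self[of T]
      by (intro Max_in) auto
    then obtain w where w: "w \<in> nodes T" "booleanwidth_of G T = booldim G (set (leaves w))"
      by blast
    have "set (leaves w) \<subseteq> pverts G"
      using leaves_nodes_subset[OF w(1)] T
      by (simp add: linear_decomposition_def decomposition_tree_def)
    then show "booleanwidth_of G T \<in> booldim G ` Pow (pverts G)"
      using w(2) by blast
  qed
qed

lemma linear_decomposition_exists:
  assumes "pair_graph G" and "pverts G \<noteq> {}"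
  shows "\<exists>T. linear_decomposition G T"
proof -
  have ex: "\<exists>T. leaves T = xs \<and> (\<forall>l r. Node l r \<in> nodes T \<longrightarrow> is_Leaf l \<or> is_Leaf r)"
    if "xs \<noteq> []" for xs :: "'a list"
    using that
  proof (induction xs rule: list_nonempty_induct)
    case (single x)
    show ?case by (rule exI[of _ "Leaf x"]) simp
  next
    case (cons x xs)
    then obtain T where
      "leaves T = xs" "\<forall>l r. Node l r \<in> nodes T \<longrightarrow> is_Leaf l \<or> is_Leaf r"
      by blast
    then show ?case by (intro exI[of _ "Node (Leaf x) T"]) auto
  qed
  have "finite (pverts G)"
    using assms by (simp add: pair_fin_digraph.pair_finite_verts pair_graph_def pair_digraph_def)
  then obtain xs where xs: "set xs = pverts G" "distinct xs"
    using finite_distinct_list by blast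
  then have "xs \<noteq> []" using assms(2) by auto
  from ex[OF this] xs show ?thesis
    unfolding linear_decomposition_def decomposition_tree_def by blast
qed

lemma path_decomposition_exists:
  assumes "pair_graph G"
  shows "path_decomposition G [pverts G]"
  using pair_wf_digraph.arc_fst_in_verts[of G] pair_wf_digraph.arc_snd_in_verts[of G] assms
  by (fastforce simp: path_decomposition_def pair_graph_def pair_digraph_def pair_fin_digraph_def)

end

theory Submission
  imports Defs
begin

text \<open>
  Order the vertices by the index of the first bag containing them and take the caterpillar
  whose nontrivial nodes are the initial segments \<open>A\<close> of this order. If the last vertex of
  \<open>A\<close> first appears in the bag \<open>B\<close>, then every vertex of \<open>A\<close> with a neighbour outside \<open>A\<close>
  lies in \<open>B\<close>: it first appears no later than \<open>B\<close>, and it shares a bag with its neighbour no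
  earlier than \<open>B\<close>. So at most \<open>2 ^ card B\<close> unions of neighbourhoods arise across the cut.
\<close>

text \<open>A vertex of \<open>A\<close> outside \<open>S\<close> contributes nothing across the
  cut, so replacing \<open>X\<close> by \<open>X \<inter> S\<close> leaves the union unchanged.
  Hence subsets of \<open>S\<close> already produce all of \<open>cut_unions G A\<close>.\<close>

lemma booldim_le_card:
  assumes "finite S"
    and boundary: "\<And>u w. u \<in> A \<Longrightarrow> w \<in> neighbors G u \<Longrightarrow> w \<notin> A \<Longrightarrow> u \<in> S"
  shows "booldim G A \<le> real (card S)"
proof -
  let ?h = "\<lambda>Y. neighborhood G Y \<inter> (pverts G - A)"
  have "?h X = ?h (X \<inter> S)" if "X \<subseteq> A" for X
    using boundary that unfolding neighborhood_def by blast
  then have sub: "cut_unions G A \<subseteq> ?h ` Pow S"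
    unfolding cut_unions_def by blast
  have fin: "finite (cut_unions G A)"
    using sub \<open>finite S\<close> by (meson finite_Pow_iff finite_imageI finite_subset)
  have "cut_unions G A \<noteq> {}"
    unfolding cut_unions_def by blast
  then have pos: "card (cut_unions G A) > 0"
    using fin by (simp add: card_gt_0_iff)
  have "card (cut_unions G A) \<le> card (?h ` Pow S)"
    using sub \<open>finite S\<close> by (intro card_mono) auto
  also have "\<dots> \<le> 2 ^ card S"
    using card_image_le[of "Pow S" ?h] \<open>finite S\<close> by (simp add: card_Pow)
  finally have "real (card (cut_unions G A)) \<le> 2 ^ card S"
    by (metis of_nat_le_iff of_nat_numeral of_nat_power)
  then have "log 2 (real (card (cut_unions G A))) \<le> log 2 (2 ^ card S)"
    using pos by (subst log_le_cancel_iff) auto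
  then show ?thesis
    by (simp add: booldim_def log_nat_power)
qed

fun caterpillar :: "'a \<Rightarrow> 'a list \<Rightarrow> 'a dtree" where
  "caterpillar x [] = Leaf x"
| "caterpillar x (y # ys) = Node (Leaf x) (caterpillar y ys)"

lemma leaves_caterpillar: "leaves (caterpillar x xs) = x # xs"
  by (induction x xs rule: caterpillar.induct) auto

lemma caterpillar_linear:
  "Node l r \<in> nodes (caterpillar x xs) \<Longrightarrow> is_Leaf l \<or> is_Leaf r"
  by (induction x xs rule: caterpillar.induct) auto

text \<open>Reduces the width of a caterpillar to two kinds of cuts: single vertices and suffixes of
  the list.\<close>

lemma nodes_caterpillar:
  assumes "w \<in> nodes (caterpillar x xs)"
  shows "is_Leaf w \<or> (\<exists>us y ys. x # xs = us @ y # ys \<and> leaves w = y # ys)"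
  using assms
proof (induction x xs rule: caterpillar.induct)
  case (2 x y ys)
  then consider "w = Node (Leaf x) (caterpillar y ys)" | "w = Leaf x"
    | "w \<in> nodes (caterpillar y ys)" by auto
  then show ?case
  proof cases
    case 1
    then have "x # y # ys = [] @ x # y # ys" "leaves w = x # y # ys"
      by (simp_all add: leaves_caterpillar)
    then show ?thesis by blast
  next
    case 3
    then show ?thesis using 2 by (metis append_Cons)
  qed simp
qed simp

definition first_bag :: "'a set list \<Rightarrow> 'a \<Rightarrow> nat" where
  "first_bag Bs v = (LEAST i. i < length Bs \<and> v \<in> Bs ! i)"

lemma first_bag:
  assumes "v \<in> \<Union> (set Bs)"
  shows "first_bag Bs v < length Bs" "v \<in> Bs ! first_bag Bs v"
proof -
  have "\<exists>i. i < length Bs \<and> v \<in> Bs ! i"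
    using assms by (auto simp: in_set_conv_nth)
  then have "first_bag Bs v < length Bs \<and> v \<in> Bs ! first_bag Bs v"
    unfolding first_bag_def by (rule LeastI_ex)
  then show "first_bag Bs v < length Bs" "v \<in> Bs ! first_bag Bs v" by auto
qed

lemma first_bag_le: "i < length Bs \<Longrightarrow> v \<in> Bs ! i \<Longrightarrow> first_bag Bs v \<le> i"
  unfolding first_bag_def by (rule Least_le) simp

text \<open>The bags containing \<open>u\<close> form an interval that starts no later than
  \<open>i\<close> and reaches a bag shared with \<open>w\<close>, hence one at or after
  \<open>i\<close>. The non-strict bounds make ties between first bags harmless.\<close>

lemma boundary_in_bag:
  assumes pd: "path_decomposition G Bs"
    and arc: "(u, w) \<in> parcs G"
    and u: "u \<in> pverts G" "first_bag Bs u \<le> i"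
    and w: "i \<le> first_bag Bs w"
  shows "u \<in> Bs ! i"
proof -
  have "u \<in> \<Union> (set Bs)"
    using pd u(1) by (simp add: path_decomposition_def)
  then have first: "u \<in> Bs ! first_bag Bs u"
    by (rule first_bag)
  obtain B where "B \<in> set Bs" "u \<in> B" "w \<in> B"
    using pd arc unfolding path_decomposition_def by blast
  then obtain k where k: "k < length Bs" "u \<in> Bs ! k" "w \<in> Bs ! k"
    by (auto simp: in_set_conv_nth)
  have "i \<le> k"
    using first_bag_le[OF k(1,3)] w by simp
  then have "Bs ! first_bag Bs u \<inter> Bs ! k \<subseteq> Bs ! i"
    using pd u(2) k(1) unfolding path_decomposition_def by blast
  then show ?thesis
    using first k(2) by auto
qed

lemma lbw_le_max_bag_size:
  assumes G: "pair_graph G" and ne: "pverts G \<noteq> {}" and pd: "path_decomposition G Bs"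
  shows "lbw G \<le> real (max_bag_size Bs)"
proof -
  have fin: "finite (pverts G)"
    using G by (simp add: pair_fin_digraph.pair_finite_verts pair_graph_def pair_digraph_def)
  have cover: "\<Union> (set Bs) = pverts G"
    using pd by (simp add: path_decomposition_def)
  have bag: "finite (Bs ! i)" "card (Bs ! i) \<le> max_bag_size Bs" if "i < length Bs" for i
    using that fin cover
    by (auto simp: max_bag_size_def intro!: finite_subset[of "Bs ! i" "pverts G"] Max_ge)
  obtain vs where vs: "set vs = pverts G" "distinct vs"
    using fin finite_distinct_list by blast
  \<comment> \<open>Nodes of the caterpillar are suffixes of its list, so the order is reversed to
    turn suffixes into initial segments of the order by first bag.\<close>
  define xs where "xs = rev (sort_key (first_bag Bs) vs)"
  have xs: "set xs = pverts G" "distinct xs"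
    using vs by (simp_all add: xs_def)
  have desc: "sorted_wrt (\<lambda>v w. first_bag Bs w \<le> first_bag Bs v) xs"
    using sorted_sort_key[of "first_bag Bs" vs]
    by (simp add: xs_def sorted_wrt_rev sorted_map)
  obtain x zs where xzs: "xs = x # zs"
    using xs(1) ne by (cases xs) auto
  let ?T = "caterpillar x zs"
  have lin: "linear_decomposition G ?T"
    using xs caterpillar_linear[of _ _ x zs]
    by (auto simp: linear_decomposition_def decomposition_tree_def leaves_caterpillar xzs)
  have "x \<in> \<Union> (set Bs)"
    using xs(1) cover xzs by auto
  note x = first_bag[OF this]
  have "card (Bs ! first_bag Bs x) > 0"
    using x bag(1) card_gt_0_iff by blast
  \<comment> \<open>Needed for the leaves: a single vertex need not be an initial segment, and its
    cut is bounded by 1 directly.\<close>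
  then have one: "1 \<le> max_bag_size Bs"
    using bag(2)[OF x(1)] by simp
  have node: "booldim G (set (leaves w)) \<le> real (max_bag_size Bs)" if "w \<in> nodes ?T" for w
    using nodes_caterpillar[OF that]
  proof
    assume "is_Leaf w"
    then obtain v where "w = Leaf v" by (cases w) auto
    then show ?thesis
      using booldim_le_card[of "{v}" "{v}" G] one by simp
  next
    assume "\<exists>us y ys. x # zs = us @ y # ys \<and> leaves w = y # ys"
    then obtain us y ys where split: "xs = us @ y # ys" and w: "leaves w = y # ys"
      using xzs by auto
    \<comment> \<open>The head \<open>y\<close> of the suffix has the latest first bag within it,
      and every vertex of \<open>us\<close> first appears at \<open>i\<close> or later.\<close>
    define i where "i = first_bag Bs y"
    have "y \<in> \<Union> (set Bs)"
      using xs(1) split cover by auto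
    then have i: "i < length Bs"
      unfolding i_def by (rule first_bag)
    have "u \<in> Bs ! i"
      if u: "u \<in> set (y # ys)" and v: "v \<in> neighbors G u" "v \<notin> set (y # ys)" for u v
    proof (rule boundary_in_bag[OF pd])
      show "(u, v) \<in> parcs G" using v by (simp add: neighbors_def)
      show "u \<in> pverts G" using u split xs(1) by auto
      show "first_bag Bs u \<le> i"
        using u desc by (auto simp: split i_def sorted_wrt_append)
      have "v \<in> set us"
        using v split xs(1) by (auto simp: neighbors_def)
      then show "i \<le> first_bag Bs v"
        using desc by (auto simp: split i_def sorted_wrt_append)
    qed
    then have "booldim G (set (y # ys)) \<le> real (card (Bs ! i))"
      by (intro booldim_le_card bag(1)[OF i])
    then show ?thesis
      using bag(2)[OF i] w by simp
  qed
  have "lbw G \<le> booleanwidth_of G ?T"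
    using ne lin finite_linear_widths[OF G] by (auto simp: lbw_def intro!: Min_le)
  also have "\<dots> \<le> real (max_bag_size Bs)"
    unfolding booleanwidth_of_def
    using node finite_nodes[of ?T] nodes_self[of ?T] by (intro Max.boundedI) auto
  finally show ?thesis .
qed

theorem theorem1:
  fixes G :: "'a pair_pre_digraph"
  assumes "pair_graph G"
  shows "lbw G \<le> of_int (pathwidth G) + 1"
proof (cases "pverts G = {}")
  case True
  \<comment> \<open>Here \<open>lbw G\<close> is 0 by convention, and \<open>pathwidth G + 1\<close>
    is a natural number cast to the integers, so the minimum need not be computed.\<close>
  then show ?thesis by (simp add: lbw_def pathwidth_def)
next
  case False
  have "\<exists>s Bs. path_decomposition G Bs \<and> max_bag_size Bs = s"
    using path_decomposition_exists[OF assms] by blast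
  \<comment> \<open>An optimal path decomposition; the summand 1 cancels the -1 in
    \<open>pathwidth\<close>.\<close>
  from LeastI_ex[OF this] obtain Bs
    where "path_decomposition G Bs" "int (max_bag_size Bs) = pathwidth G + 1"
    unfolding pathwidth_def by auto
  with lbw_le_max_bag_size[OF assms False] show ?thesis
    by (metis of_int_1 of_int_add of_int_of_nat_eq)
qed

end
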